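(* Let $k$ be a positive integer that is not a perfect square. There exist constants $c_1, c_2, C_1, C_2 > 0$ depending only on $k$ such that for every constant $p \ge 1$ there is $N_0 = N_0(k,p)$ such that for every $N \ge N_0$ the following holds. Let $A_N = \{ x_1 + x_2\sqrt{k} : x_1, x_2 \in \mathbb{Z} \cap [-\sqrt{N}, \sqrt{N}] \}$, let $\mathcal{P} = A_N \times A_N \subset \mathbb{R}^2$, and let $n = |A_N| = |\mathcal{P}|^{1/2}$. Then there exist an integer $m$ with $c_1 p \le m \le c_2 p$ and one-dimensional projections $\pi_1, \dots, \pi_m$ of the plane along $m$ pairwise distinct directions such that $$ C_1 \sqrt{p}\, n \le |\pi_i(\mathcal{P})| \le C_2 \sqrt{p}\, n \qquad \text{for every } i = 1, \dots, m. $$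
   Context: The one-dimensional projection of a finite point set $\mathcal{P} \subset \mathbb{R}^2$ along a given direction is its image under the linear projection $\mathbb{R}^2 \to \mathbb{R}$ whose fibres are the lines parallel to that direction; equivalently, its size $|\pi(\mathcal{P})|$ is the number of distinct lines parallel to that direction containing at least one point of $\mathcal{P}$. *)

theory Defs
  imports "HOL-Analysis.Analysis"
begin

text \<open>A direction in the plane is a line through the origin; distinct directions are
  distinct such lines, regardless of the choice of spanning vector.\<close>

definition plane_direction :: "(real \<times> real) set \<Rightarrow> bool" where
  "plane_direction D \<longleftrightarrow> subspace D \<and> dim D = 1"

text \<open>The fibre through \<open>x\<close> has to be the line through \<open>x\<close> parallel to \<open>D\<close>.  This determines
  \<open>\<pi>\<close> only up to a nonzero scalar factor, which does not affect the size of an image.\<close>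

definition projection_along :: "(real \<times> real) set \<Rightarrow> (real \<times> real \<Rightarrow> real) \<Rightarrow> bool" where
  "projection_along D \<pi> \<longleftrightarrow> linear \<pi> \<and> (\<forall>x. {y. \<pi> y = \<pi> x} = {x + d | d. d \<in> D})"

definition A_set :: "nat \<Rightarrow> real \<Rightarrow> real set" where
  "A_set k N = {of_int x1 + of_int x2 * sqrt (real k) | x1 x2 :: int.
     of_int x1 \<in> {- sqrt N .. sqrt N} \<and> of_int x2 \<in> {- sqrt N .. sqrt N}}"

end

theory Submission
  imports Defs
begin

text \<open>
  Projecting along slope \<open>\<theta>\<close> amounts to counting the values \<open>x - \<theta> * y\<close> with \<open>x, y\<close> in the
  box \<open>A_set k N\<close> of the ring \<open>\<int>[sqrt k]\<close>, whose radius is \<open>R = sqrt N\<close>.  The directions are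
  those with \<open>\<theta> = a / b\<close>, where \<open>a, b\<close> are ring elements with coordinates of size \<open>T\<close> and
  \<open>T ^ 4\<close> is about \<open>p\<close>.

  \<^emph>\<open>Upper bound.\<close> Multiplying the values by \<open>b\<close> moves them into a box of radius \<open>O(T * R)\<close> of
  the same ring, so there are \<open>O(T\<^sup>2 * R\<^sup>2)\<close> of them, and \<open>T\<^sup>2\<close> is about \<open>sqrt p\<close>
  while \<open>R\<^sup>2\<close> is about \<open>n\<close> (\<open>card_projection_le\<close>).

  \<^emph>\<open>Lower bound.\<close> Two points of a fibre have second coordinates that differ by a denominator of
  \<open>\<theta>\<close>, that is, by a ring element \<open>v\<close> for which \<open>\<theta> * v\<close> lies in the ring.  If all nonzero
  denominators of \<open>\<theta>\<close> have height at least \<open>s\<close>, then the second coordinates are \<open>s\<close>-separated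
  and a fibre has \<open>O((R / s)\<^sup>2)\<close> points (\<open>packing\<close>).  For \<open>s\<close> of order \<open>T\<close> there are hence
  at least about \<open>T\<^sup>2 * n\<close> values (\<open>card_projection_ge\<close>).

  \<^emph>\<open>Number of directions.\<close> It remains to find about \<open>T ^ 4\<close> ratios \<open>a / b\<close> without a nonzero
  denominator of height below \<open>\<epsilon> * T\<close>.  As \<open>\<int>[sqrt k]\<close> need not have unique factorization,
  reduced fractions are of no use; the ratios with small denominators are counted instead.  If
  the least height of a denominator of \<open>\<theta>\<close> is \<open>h\<close>, attained at \<open>v\<close>, then by separation only
  \<open>O((T / h)\<^sup>2)\<close> pairs \<open>(a, b)\<close> have ratio \<open>\<theta>\<close>.  The element \<open>\<theta> * v\<close> has height
  \<open>O(h)\<close>, so each \<open>v\<close> belongs to \<open>O(h\<^sup>2)\<close> ratios and thus to \<open>O(T\<^sup>2)\<close> pairs, whatever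
  \<open>h\<close> is.  With \<open>O(\<epsilon>\<^sup>2 * T\<^sup>2)\<close> choices of \<open>v\<close> this makes
  \<open>O(\<epsilon>\<^sup>2 * T ^ 4)\<close> bad pairs (\<open>card_pairs_small_denominator\<close>), fewer than half of all pairs
  when \<open>\<epsilon>\<close> is small.  Each remaining ratio arises from boundedly many pairs, so about
  \<open>T ^ 4\<close> good ratios are left (\<open>card_good_ratios_ge\<close>).

  The height of \<open>\<theta> * v\<close> is controlled by \<open>ratio_times_bounded\<close>, which needs both conjugates of
  \<open>\<theta>\<close> to be bounded: this is why \<open>b\<close> is restricted to elements of norm at least \<open>T\<^sup>2\<close>.
\<close>

section \<open>Boxes in a real quadratic order\<close>

locale real_quadratic_order =
  fixes k :: nat
  assumes nonsquare: "\<nexists>j :: nat. k = j\<^sup>2"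
begin

definition elt :: "int \<Rightarrow> int \<Rightarrow> real" where
  "elt x y = of_int x + of_int y * sqrt (real k)"

definition qring :: "real set" where
  "qring = {elt x y | x y. True}"

definition qbox :: "real \<Rightarrow> real set" where
  "qbox R = {elt x y | x y. \<bar>of_int x\<bar> \<le> R \<and> \<bar>of_int y\<bar> \<le> R}"

text \<open>The height of a ring element is the radius of the smallest box that contains it.  The
  condition says that every nonzero denominator of \<open>\<theta>\<close> has height at least \<open>s\<close>.\<close>

definition denominator_gap :: "real \<Rightarrow> real \<Rightarrow> bool" where
  "denominator_gap \<theta> s \<longleftrightarrow>
    (\<forall>r. \<forall>v\<in>qbox r. v \<noteq> 0 \<longrightarrow> \<theta> * v \<in> qring \<longrightarrow> s \<le> r)"

text \<open>This is the irrationality of \<open>sqrt k\<close>; it makes coordinates in the ring well defined.\<close>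

lemma elt_eq_0_iff: "elt x y = 0 \<longleftrightarrow> x = 0 \<and> y = 0"
proof
  assume e: "elt x y = 0"
  have "of_int x = - (of_int y * sqrt (real k))"
    using e by (simp add: elt_def)
  hence "(of_int x)\<^sup>2 = (of_int y * sqrt (real k))\<^sup>2"
    by simp
  hence "real_of_int (x\<^sup>2) = real_of_int (y\<^sup>2 * int k)"
    by (simp add: power_mult_distrib)
  hence sq: "x\<^sup>2 = y\<^sup>2 * int k"
    by (simp only: of_int_eq_iff)
  have "y = 0"
  proof (rule ccontr)
    assume "y \<noteq> 0"
    have "y\<^sup>2 dvd x\<^sup>2" using sq by simp
    hence "y dvd x" by simp
    then obtain c where "x = y * c" by auto
    hence "int k = c\<^sup>2" using sq \<open>y \<noteq> 0\<close> by (simp add: power_mult_distrib)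
    hence "k = (nat \<bar>c\<bar>)\<^sup>2"
      by (metis nat_int nat_power_eq abs_ge_zero power2_abs)
    thus False using nonsquare by blast
  qed
  thus "x = 0 \<and> y = 0" using sq by simp
qed (simp add: elt_def)

lemma elt_diff: "elt x y - elt x' y' = elt (x - x') (y - y')"
  by (simp add: elt_def algebra_simps)

lemma elt_eq_iff: "elt x y = elt x' y' \<longleftrightarrow> x = x' \<and> y = y'"
  using elt_eq_0_iff[of "x - x'" "y - y'"] elt_diff[of x y x' y'] by auto

lemma elt_mult:
  "elt x y * elt x' y' = elt (x * x' + int k * (y * y')) (x * y' + y * x')"
proof -
  have s: "sqrt (real k) * sqrt (real k) = real k" by simp
  have "elt x y * elt x' y' = of_int x * of_int x' + of_int y * of_int y' * (sqrt (real k) * sqrt (real k))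
     + (of_int x * of_int y' + of_int y * of_int x') * sqrt (real k)"
    by (simp add: elt_def algebra_simps)
  thus ?thesis by (simp only: s) (simp add: elt_def algebra_simps)
qed

lemma qbox_imp_qring: "v \<in> qbox R \<Longrightarrow> v \<in> qring"
  by (auto simp: qbox_def qring_def)

lemma qring_diff: "u \<in> qring \<Longrightarrow> v \<in> qring \<Longrightarrow> u - v \<in> qring"
  unfolding qring_def using elt_diff by blast

lemma qbox_nonneg: "v \<in> qbox R \<Longrightarrow> 0 \<le> R"
  by (auto simp: qbox_def)

lemma qbox_mono: "v \<in> qbox R \<Longrightarrow> R \<le> S \<Longrightarrow> v \<in> qbox S"
  by (fastforce simp: qbox_def)

lemma qbox_diff:
  assumes "u \<in> qbox R" "v \<in> qbox S"
  shows "u - v \<in> qbox (R + S)"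
proof -
  obtain x y x' y' where e: "u = elt x y" "v = elt x' y'"
    and "\<bar>of_int x\<bar> \<le> R" "\<bar>of_int y\<bar> \<le> R" "\<bar>of_int x'\<bar> \<le> S" "\<bar>of_int y'\<bar> \<le> S"
    using assms by (auto simp: qbox_def)
  hence "\<bar>of_int (x - x')\<bar> \<le> R + S" "\<bar>of_int (y - y')\<bar> \<le> R + S"
    by auto
  thus ?thesis unfolding e elt_diff qbox_def by blast
qed

lemma qbox_mult:
  assumes "u \<in> qbox R" "v \<in> qbox S"
  shows "u * v \<in> qbox ((1 + real k) * R * S)"
proof -
  obtain x y x' y' where e: "u = elt x y" "v = elt x' y'"
    and b: "\<bar>real_of_int x\<bar> \<le> R" "\<bar>real_of_int y\<bar> \<le> R"
      "\<bar>real_of_int x'\<bar> \<le> S" "\<bar>real_of_int y'\<bar> \<le> S"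
    using assms by (auto simp: qbox_def)
  have R: "0 \<le> R" and S: "0 \<le> S" using assms qbox_nonneg by auto
  have m: "\<bar>real_of_int p * of_int q\<bar> \<le> R * S"
    if "\<bar>real_of_int p\<bar> \<le> R" "\<bar>real_of_int q\<bar> \<le> S" for p q
    unfolding abs_mult using that R by (intro mult_mono) auto
  have m1: "\<bar>real_of_int x * of_int x'\<bar> \<le> R * S" and m2: "\<bar>real_of_int y * of_int y'\<bar> \<le> R * S"
    and m3: "\<bar>real_of_int x * of_int y'\<bar> \<le> R * S" and m4: "\<bar>real_of_int y * of_int x'\<bar> \<le> R * S"
    using b by (auto intro: m)
  have k: "k \<ge> 1" using nonsquare by (cases k) (auto dest: spec[of _ 0])
  have "\<bar>real k * (real_of_int y * of_int y')\<bar> \<le> real k * (R * S)"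
    unfolding abs_mult[of "real k"] using m2 by (intro mult_mono) auto
  hence 1: "\<bar>real_of_int (x * x' + int k * (y * y'))\<bar> \<le> (1 + real k) * R * S"
    using m1 by (simp add: algebra_simps)
  have "R * S \<le> real k * (R * S)"
    using k R S mult_right_mono[of 1 "real k" "R * S"] by simp
  hence 2: "\<bar>real_of_int (x * y' + y * x')\<bar> \<le> (1 + real k) * R * S"
    using m3 m4 by (simp add: algebra_simps)
  show ?thesis using 1 2 unfolding e elt_mult qbox_def by blast
qed

definition coord_square :: "real \<Rightarrow> (int \<times> int) set" where
  "coord_square R = {-\<lfloor>R\<rfloor>..\<lfloor>R\<rfloor>} \<times> {-\<lfloor>R\<rfloor>..\<lfloor>R\<rfloor>}"

lemma mem_coord_square:
  "(x, y) \<in> coord_square R \<longleftrightarrow> \<bar>real_of_int x\<bar> \<le> R \<and> \<bar>real_of_int y\<bar> \<le> R"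
  unfolding coord_square_def by (auto simp: abs_le_iff le_floor_iff) (linarith)+

lemma finite_coord_square: "finite (coord_square R)"
  by (simp add: coord_square_def)

lemma card_coord_square:
  assumes "0 \<le> R"
  shows "real (card (coord_square R)) = (2 * of_int \<lfloor>R\<rfloor> + 1)\<^sup>2"
proof -
  have "0 \<le> \<lfloor>R\<rfloor>" using assms by simp
  thus ?thesis by (simp add: coord_square_def power2_eq_square)
qed

lemma qbox_eq_image: "qbox R = case_prod elt ` coord_square R"
  by (force simp: qbox_def mem_coord_square image_iff)

lemma finite_qbox: "finite (qbox R)"
  unfolding qbox_eq_image by (intro finite_imageI finite_coord_square)

lemma card_qbox: "card (qbox R) = card (coord_square R)"
  unfolding qbox_eq_image by (intro card_image) (auto simp: inj_on_def elt_eq_iff)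

lemma card_qbox_bounds:
  assumes "1 \<le> R"
  shows "R\<^sup>2 \<le> card (qbox R)" "real (card (qbox R)) \<le> 9 * R\<^sup>2"
proof -
  have f: "1 \<le> \<lfloor>R\<rfloor>" "R < of_int \<lfloor>R\<rfloor> + 1" "of_int \<lfloor>R\<rfloor> \<le> R"
    using assms by linarith+
  have c: "real (card (qbox R)) = (2 * of_int \<lfloor>R\<rfloor> + 1)\<^sup>2"
    using assms by (simp add: card_qbox card_coord_square)
  show "R\<^sup>2 \<le> card (qbox R)"
    unfolding c using f assms by (intro power_mono) linarith+
  have "(2 * real_of_int \<lfloor>R\<rfloor> + 1)\<^sup>2 \<le> (3 * R)\<^sup>2"
    using f assms by (intro power_mono) linarith+
  thus "real (card (qbox R)) \<le> 9 * R\<^sup>2"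
    unfolding c by (simp add: power_mult_distrib)
qed

lemma card_coord_square_nonzero:
  assumes "0 \<le> H"
  shows "real (card (coord_square H - {(0, 0)})) \<le> 9 * H\<^sup>2"
proof (cases "H < 1")
  case True
  hence "\<lfloor>H\<rfloor> = 0" using assms by linarith
  hence "coord_square H - {(0, 0)} = {}" by (auto simp: coord_square_def)
  thus ?thesis by (simp only: card.empty) simp
next
  case False
  have "card (coord_square H - {(0, 0)}) \<le> card (qbox H)"
    unfolding card_qbox by (intro card_mono finite_coord_square) auto
  thus ?thesis using card_qbox_bounds(2)[of H] False by linarith
qed

section \<open>Denominators of a slope\<close>

text \<open>Cut the plane of coordinates into square cells of side \<open>s\<close>.  Two elements of \<open>Y\<close> in the same
  cell differ by a denominator of height below \<open>s\<close>, which must be zero; so \<open>Y\<close> has no more elements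
  than there are cells meeting the box of radius \<open>R\<close>.\<close>

lemma packing:
  assumes gap: "denominator_gap \<theta> s" and s: "0 < s" and R: "s \<le> R"
    and Y: "Y \<subseteq> qbox R"
    and diff: "\<And>y z. y \<in> Y \<Longrightarrow> z \<in> Y \<Longrightarrow> \<theta> * (y - z) \<in> qring"
  shows "real (card Y) \<le> (4 * R / s)\<^sup>2"
proof -
  define X where "X = {t \<in> coord_square R. case_prod elt t \<in> Y}"
  have YX: "Y = case_prod elt ` X"
    using Y unfolding X_def qbox_eq_image by auto
  have finX: "finite X" by (simp add: X_def finite_coord_square)
  \<comment> \<open>The cell of side \<open>s\<close> that contains a given point.\<close>
  define cell where "cell = (\<lambda>(x :: int, y :: int). (\<lfloor>of_int x / s\<rfloor>, \<lfloor>of_int y / s\<rfloor>))"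
  have near: "\<bar>real_of_int (x - x')\<bar> < s" if "\<lfloor>of_int x / s\<rfloor> = \<lfloor>of_int x' / s\<rfloor>" for x x' :: int
  proof -
    have "\<bar>of_int x / s - of_int x' / s\<bar> < 1" using that by linarith
    hence "\<bar>(of_int x - of_int x') / s\<bar> < 1" by (simp add: diff_divide_distrib)
    thus ?thesis using s by (simp add: abs_divide divide_simps)
  qed
  have "inj_on cell X"
  proof (rule inj_onI, clarify)
    fix x y x' y'
    assume XX: "(x, y) \<in> X" "(x', y') \<in> X" and "cell (x, y) = cell (x', y')"
    hence n: "\<bar>real_of_int (x - x')\<bar> < s" "\<bar>real_of_int (y - y')\<bar> < s"
      using near by (auto simp: cell_def)
    define r where "r = max \<bar>real_of_int (x - x')\<bar> \<bar>real_of_int (y - y')\<bar>"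
    have "\<bar>real_of_int (x - x')\<bar> \<le> r" "\<bar>real_of_int (y - y')\<bar> \<le> r"
      unfolding r_def by (rule max.cobounded1, rule max.cobounded2)
    hence "elt x y - elt x' y' \<in> qbox r"
      unfolding elt_diff qbox_def by blast
    moreover have "\<theta> * (elt x y - elt x' y') \<in> qring"
      using XX diff by (auto simp: X_def)
    moreover have "r < s" using n by (simp add: r_def)
    ultimately have "elt x y - elt x' y' = 0"
      using gap unfolding denominator_gap_def by force
    thus "x = x' \<and> y = y'" by (simp add: elt_eq_iff)
  qed
  moreover have "cell ` X \<subseteq> {\<lfloor>- R / s\<rfloor>..\<lfloor>R / s\<rfloor>} \<times> {\<lfloor>- R / s\<rfloor>..\<lfloor>R / s\<rfloor>}"
  proof -
    have "\<lfloor>- R / s\<rfloor> \<le> \<lfloor>of_int x / s\<rfloor> \<and> \<lfloor>of_int x / s\<rfloor> \<le> \<lfloor>R / s\<rfloor>"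
      if "\<bar>real_of_int x\<bar> \<le> R" for x
      using that s by (intro conjI floor_mono divide_right_mono) auto
    thus ?thesis by (auto simp: X_def cell_def mem_coord_square)
  qed
  ultimately have "card X \<le> card ({\<lfloor>- R / s\<rfloor>..\<lfloor>R / s\<rfloor>} \<times> {\<lfloor>- R / s\<rfloor>..\<lfloor>R / s\<rfloor>})"
    by (metis card_image card_mono finite_SigmaI finite_atLeastAtMost_int)
  hence "real (card X) \<le> (real (nat (\<lfloor>R / s\<rfloor> - \<lfloor>- R / s\<rfloor> + 1)))\<^sup>2"
    by (simp add: power2_eq_square flip: of_nat_mult)
  also have "\<dots> \<le> (4 * R / s)\<^sup>2"
  proof (intro power_mono)
    have "1 \<le> R / s" using R s by simp
    moreover have "- R / s = - (R / s)" "4 * R / s = 4 * (R / s)" by simp_all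
    ultimately show "real (nat (\<lfloor>R / s\<rfloor> - \<lfloor>- R / s\<rfloor> + 1)) \<le> 4 * R / s"
      by linarith
  qed simp
  finally have "real (card X) \<le> (4 * R / s)\<^sup>2" .
  moreover have "card Y \<le> card X" unfolding YX by (rule card_image_le[OF finX])
  ultimately show ?thesis by linarith
qed

text \<open>Heights are natural numbers, so a denominator of least height exists.  Its height is then
  itself a gap for \<open>\<theta>\<close>, so that a bad pair can be charged to a denominator whose height matches
  the separation that the packing bound uses.\<close>

lemma exists_minimal_denominator:
  assumes "\<not> denominator_gap \<theta> H"
  obtains x y where "(x, y) \<in> coord_square H" "(x, y) \<noteq> (0, 0)" "\<theta> * elt x y \<in> qring"
    "denominator_gap \<theta> (max \<bar>of_int x\<bar> \<bar>of_int y\<bar>)"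
proof -
  define P where "P = (\<lambda>t. t \<noteq> (0, 0) \<and> \<theta> * case_prod elt t \<in> qring)"
  define h where "h = (\<lambda>(x :: int, y :: int). nat (max \<bar>x\<bar> \<bar>y\<bar>))"
  have h: "real (h (x, y)) \<le> r \<longleftrightarrow> \<bar>of_int x\<bar> \<le> r \<and> \<bar>of_int y\<bar> \<le> r" for x y r
    by (auto simp: h_def max_def)
  obtain r v where v: "v \<in> qbox r" "v \<noteq> 0" "\<theta> * v \<in> qring" "r < H"
    using assms by (auto simp: denominator_gap_def not_le)
  then obtain t0 where t0: "P t0" "real (h t0) \<le> r"
    by (auto simp: qbox_eq_image mem_coord_square h P_def elt_eq_0_iff)
  obtain t where t: "P t" "\<And>u. P u \<Longrightarrow> h t \<le> h u"
    using ex_has_least_nat[of P t0 h] t0(1) by blast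
  obtain x y where xy: "t = (x, y)" by force
  have ht: "real (h t) = max \<bar>of_int x\<bar> \<bar>of_int y\<bar>" by (auto simp: xy h_def max_def)
  have "real (h t) \<le> H" using t(2)[OF t0(1)] t0(2) v(4) by linarith
  hence "(x, y) \<in> coord_square H" by (simp add: xy h mem_coord_square)
  moreover have "denominator_gap \<theta> (real (h t))"
    unfolding denominator_gap_def
  proof (intro allI ballI impI)
    fix r v assume "v \<in> qbox r" "v \<noteq> 0" "\<theta> * v \<in> qring"
    then obtain u where "P u" "real (h u) \<le> r"
      by (auto simp: qbox_eq_image mem_coord_square h P_def elt_eq_0_iff)
    thus "real (h t) \<le> r" using t(2)[of u] by linarith
  qed
  ultimately show ?thesis using that t(1) ht by (auto simp: xy P_def)
qed

section \<open>Ratios with a denominator of large norm\<close>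

text \<open>For \<open>b = elt x y\<close> in this set the norm \<open>x\<^sup>2 - k * y\<^sup>2\<close> is at least
  \<open>((k + 1)\<^sup>2 - k) * T\<^sup>2\<close>, which exceeds \<open>T\<^sup>2\<close> if \<open>T > 0\<close>, although both coordinates range
  over intervals of length \<open>T\<close>.\<close>

definition large_norm :: "nat \<Rightarrow> real set" where
  "large_norm T = case_prod elt ` ({(int k + 1) * int T..(int k + 2) * int T} \<times> {0..int T})"

lemma large_norm_subset: "large_norm T \<subseteq> qbox ((real k + 2) * real T)"
proof
  fix b assume "b \<in> large_norm T"
  then obtain x y where b: "b = elt x y" "(int k + 1) * int T \<le> x" "x \<le> (int k + 2) * int T"
    "0 \<le> y" "y \<le> int T" by (auto simp: large_norm_def)
  have "0 \<le> (int k + 1) * int T" by simp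
  hence "0 \<le> x" using b(2) by linarith
  moreover have "real_of_int x \<le> real_of_int ((int k + 2) * int T)"
    using b(3) by (simp only: of_int_le_iff)
  ultimately have x: "\<bar>real_of_int x\<bar> \<le> (real k + 2) * real T" by simp
  have "real_of_int y \<le> real T" using b(5) by linarith
  moreover have "real T \<le> (real k + 2) * real T" by (simp add: algebra_simps)
  ultimately have "\<bar>real_of_int y\<bar> \<le> (real k + 2) * real T" using b(4) by simp
  with x b(1) show "b \<in> qbox ((real k + 2) * real T)"
    unfolding qbox_def by blast
qed

lemma card_large_norm: "T\<^sup>2 \<le> card (large_norm T)"
proof -
  have "card (large_norm T) = (T + 1)\<^sup>2"
  proof -
    have "card (large_norm T) = card ({(int k + 1) * int T..(int k + 2) * int T} \<times> {0..int T})"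
      unfolding large_norm_def by (intro card_image) (auto simp: inj_on_def elt_eq_iff)
    also have "\<dots> = (T + 1)\<^sup>2"
      by (simp add: card_cartesian_product power2_eq_square algebra_simps nat_add_distrib)
    finally show ?thesis .
  qed
  thus ?thesis by (simp add: power2_eq_square)
qed

lemma large_norm_nonzero:
  assumes "1 \<le> T" "b \<in> large_norm T"
  shows "b \<noteq> 0"
proof -
  obtain x y where b: "b = elt x y" "(int k + 1) * int T \<le> x"
    using assms by (auto simp: large_norm_def)
  have "0 < (int k + 1) * int T" using assms(1) by simp
  thus ?thesis using b by (auto simp: elt_eq_0_iff)
qed

text \<open>Let \<open>n\<close> be the norm of \<open>b\<close> and \<open>b'\<close> its conjugate.  Then \<open>n * (a / b * v) = a * b' * v\<close> has
  height \<open>O(T\<^sup>2 * S)\<close>, and dividing by the integer \<open>n \<ge> T\<^sup>2\<close> acts on each coordinate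
  separately.\<close>

lemma ratio_times_bounded:
  assumes T: "1 \<le> T" and a: "a \<in> qbox (real T)" and b: "b \<in> large_norm T"
    and v: "v \<in> qbox S" and u: "a / b * v \<in> qring"
  shows "a / b * v \<in> qbox ((1 + real k)\<^sup>2 * (real k + 2) * S)"
proof -
  obtain x y where b': "b = elt x y" "(int k + 1) * int T \<le> x" "0 \<le> y" "y \<le> int T"
    using b by (auto simp: large_norm_def)
  obtain p q where pq: "a / b * v = elt p q" using u by (auto simp: qring_def)
  define n where "n = x\<^sup>2 - int k * y\<^sup>2"
  have n: "real T ^ 2 \<le> real_of_int n"
  proof -
    have "((int k + 1) * int T)\<^sup>2 \<le> x\<^sup>2" using b'(2) by (intro power_mono) auto
    moreover have "int k * y\<^sup>2 \<le> int k * (int T)\<^sup>2"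
      using b' by (intro mult_left_mono power_mono) auto
    moreover have "((int k + 1) * int T)\<^sup>2 = (int T)\<^sup>2 + int k * (int T)\<^sup>2 + (int k * int T)\<^sup>2 + int k * (int T)\<^sup>2"
      by (simp add: power2_eq_square algebra_simps)
    moreover have "0 \<le> int k * (int T)\<^sup>2" "0 \<le> (int k * int T)\<^sup>2" by simp_all
    ultimately have "(int T)\<^sup>2 \<le> n" unfolding n_def by linarith
    hence "real_of_int ((int T)\<^sup>2) \<le> real_of_int n" by (simp only: of_int_le_iff)
    thus ?thesis by simp
  qed
  have conj: "elt x (- y) \<in> qbox ((real k + 2) * real T)"
  proof -
    have "elt x y \<in> qbox ((real k + 2) * real T)" using b b'(1) large_norm_subset by auto
    thus ?thesis by (fastforce simp: qbox_def elt_eq_iff)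
  qed
  define X where "X = (1 + real k)\<^sup>2 * (real k + 2) * (real T)\<^sup>2 * S"
  have "a * elt x (- y) * v \<in> qbox X"
    using qbox_mult[OF qbox_mult[OF a conj] v]
    by (simp add: X_def power2_eq_square mult_ac)
  moreover have "a * elt x (- y) * v = elt (n * p) (n * q)"
  proof -
    have "elt x y * elt x (- y) = of_int n"
      unfolding elt_mult by (simp add: n_def elt_def power2_eq_square)
    moreover have "b \<noteq> 0" by (rule large_norm_nonzero[OF T b])
    hence "a * v = elt p q * b" using pq by (simp add: field_simps)
    ultimately have "a * elt x (- y) * v = of_int n * elt p q"
      using b'(1) by (metis mult.assoc mult.commute)
    thus ?thesis by (simp add: elt_def algebra_simps)
  qed
  ultimately have np: "\<bar>real_of_int n * of_int p\<bar> \<le> X" "\<bar>real_of_int n * of_int q\<bar> \<le> X"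
    by (auto simp: qbox_def elt_eq_iff)
  define Y where "Y = (1 + real k)\<^sup>2 * (real k + 2) * S"
  have S: "0 \<le> S" using v qbox_nonneg by auto
  hence Y0: "0 \<le> Y" by (simp add: Y_def)
  have n0: "0 < real_of_int n" using n T by (rule_tac less_le_trans[of _ "(real T)\<^sup>2"]) auto
  have "X = (real T)\<^sup>2 * Y" by (simp add: X_def Y_def)
  also have "\<dots> \<le> real_of_int n * Y" using n Y0 by (intro mult_right_mono)
  finally have "real_of_int n * \<bar>real_of_int p\<bar> \<le> real_of_int n * Y"
    "real_of_int n * \<bar>real_of_int q\<bar> \<le> real_of_int n * Y"
    using np n0 unfolding abs_mult by linarith+
  hence "\<bar>real_of_int p\<bar> \<le> Y" "\<bar>real_of_int q\<bar> \<le> Y"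
    using n0 by (simp_all only: mult_le_cancel_left_pos)
  thus ?thesis unfolding pq qbox_def Y_def by blast
qed

text \<open>A pair with ratio \<open>\<theta>\<close> is determined by \<open>b\<close>, and every such \<open>b\<close> is a denominator of \<open>\<theta>\<close>,
  so the packing bound applies.\<close>

lemma card_pairs_with_ratio:
  assumes T: "1 \<le> T" and gap: "denominator_gap \<theta> s" and s: "0 < s" "s \<le> (real k + 2) * real T"
  shows "real (card {(a, b) \<in> qbox (real T) \<times> large_norm T. a / b = \<theta>})
    \<le> (4 * ((real k + 2) * real T) / s)\<^sup>2" (is "real (card ?F) \<le> _")
proof -
  have nz: "b \<noteq> 0" if "b \<in> large_norm T" for b
    by (rule large_norm_nonzero[OF T that])
  have "inj_on snd ?F" using nz by (auto simp: inj_on_def)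
  hence "card ?F = card (snd ` ?F)" by (simp add: card_image)
  moreover have "real (card (snd ` ?F)) \<le> (4 * ((real k + 2) * real T) / s)\<^sup>2"
  proof (rule packing[OF gap s])
    show "snd ` ?F \<subseteq> qbox ((real k + 2) * real T)" using large_norm_subset[of T] by auto
    have "\<theta> * b \<in> qring" if "b \<in> snd ` ?F" for b
      using that nz by (auto intro: qbox_imp_qring)
    thus "\<theta> * (b - b') \<in> qring" if "b \<in> snd ` ?F" "b' \<in> snd ` ?F" for b b'
      unfolding right_diff_distrib using that by (intro qring_diff)
  qed
  ultimately show ?thesis by simp
qed

text \<open>Each bad pair is attached to coordinates \<open>t\<close> of a least denominator of \<open>a / b\<close> and to the
  element \<open>w\<close> that this denominator yields when multiplied by \<open>a / b\<close>.  There are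
  \<open>O(h(t)\<^sup>2)\<close> possible \<open>w\<close> and \<open>O((T / h(t))\<^sup>2)\<close> pairs for each, so the heights cancel
  and only the number of \<open>t\<close> matters.\<close>

lemma card_pairs_small_denominator:
  assumes T: "1 \<le> T" and H: "0 \<le> H" "H \<le> (real k + 2) * real T"
  defines "c \<equiv> (1 + real k)\<^sup>2 * (real k + 2)"
  shows "real (card {(a, b) \<in> qbox (real T) \<times> large_norm T. \<not> denominator_gap (a / b) H})
    \<le> 1296 * c\<^sup>2 * ((real k + 2) * real T)\<^sup>2 * H\<^sup>2" (is "real (card ?B) \<le> _")
proof -
  let ?T' = "(real k + 2) * real T"
  define h where "h = (\<lambda>(x :: int, y :: int). max \<bar>real_of_int x\<bar> \<bar>real_of_int y\<bar>)"
  define I where "I = coord_square H - {(0, 0)}"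
  \<comment> \<open>Pairs attached to \<open>t\<close> and \<open>w\<close>; the gap condition records that \<open>t\<close> has least height.\<close>
  define F where "F = (\<lambda>t w. {(a, b) \<in> qbox (real T) \<times> large_norm T.
    a / b = w / case_prod elt t \<and> denominator_gap (a / b) (h t)})"
  have c1: "1 \<le> c"
  proof -
    have "1 * 1 \<le> (1 + real k)\<^sup>2 * (real k + 2)"
      by (intro mult_mono) (auto simp: one_le_power)
    thus ?thesis by (simp add: c_def)
  qed
  have finI: "finite I" by (simp add: I_def finite_coord_square)
  have hI: "1 \<le> h t" "h t \<le> ?T'" if "t \<in> I" for t
  proof -
    obtain x y where t: "t = (x, y)" by force
    have "x \<noteq> 0 \<or> y \<noteq> 0" using that by (auto simp: I_def t)
    hence "1 \<le> \<bar>x\<bar> \<or> 1 \<le> \<bar>y\<bar>" by linarith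
    thus "1 \<le> h t" unfolding h_def t by (simp add: le_max_iff_disj) linarith
    show "h t \<le> ?T'" using that H(2) by (auto simp: I_def t h_def mem_coord_square)
  qed
  have fin: "finite (qbox (real T) \<times> large_norm T)"
    by (simp add: finite_qbox finite_subset[OF large_norm_subset])
  have finF: "finite (F t w)" for t w
    unfolding F_def by (rule finite_subset[OF _ fin]) auto
  have cardF: "real (card (F t w)) \<le> (4 * ?T' / h t)\<^sup>2" if t: "t \<in> I" for t w
  proof (cases "denominator_gap (w / case_prod elt t) (h t)")
    case True
    have "card (F t w) \<le> card {(a, b) \<in> qbox (real T) \<times> large_norm T. a / b = w / case_prod elt t}"
      by (rule card_mono) (auto simp: F_def intro: finite_subset[OF _ fin])
    thus ?thesis using card_pairs_with_ratio[OF T True] hI[OF t] by fastforce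
  next
    case False
    hence "F t w = {}" by (auto simp: F_def)
    thus ?thesis by simp
  qed
  have "?B \<subseteq> (\<Union>t\<in>I. \<Union>w\<in>qbox (c * h t). F t w)"
  proof clarify
    fix a b assume ab: "a \<in> qbox (real T)" "b \<in> large_norm T" and "\<not> denominator_gap (a / b) H"
    then obtain x y where xy: "(x, y) \<in> coord_square H" "(x, y) \<noteq> (0, 0)"
      "a / b * elt x y \<in> qring" "denominator_gap (a / b) (h (x, y))"
      using exists_minimal_denominator[of "a / b" H] unfolding h_def prod.case by metis
    have "\<bar>real_of_int x\<bar> \<le> h (x, y)" "\<bar>real_of_int y\<bar> \<le> h (x, y)"
      by (simp_all add: h_def)
    hence "elt x y \<in> qbox (h (x, y))" unfolding qbox_def by blast
    from ratio_times_bounded[OF T ab this xy(3)]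
    have "a / b * elt x y \<in> qbox (c * h (x, y))" by (simp add: c_def)
    moreover have "(a, b) \<in> F (x, y) (a / b * elt x y)"
      using ab xy elt_eq_0_iff[of x y] by (auto simp: F_def)
    ultimately show "(a, b) \<in> (\<Union>t\<in>I. \<Union>w\<in>qbox (c * h t). F t w)"
      using xy(1,2) by (auto simp: I_def)
  qed
  hence "card ?B \<le> card (\<Union>t\<in>I. \<Union>w\<in>qbox (c * h t). F t w)"
    by (intro card_mono) (auto simp: finI finite_qbox finF)
  also have "\<dots> \<le> (\<Sum>t\<in>I. card (\<Union>w\<in>qbox (c * h t). F t w))"
    by (rule card_UN_le[OF finI])
  also have "\<dots> \<le> (\<Sum>t\<in>I. \<Sum>w\<in>qbox (c * h t). card (F t w))"
    by (intro sum_mono card_UN_le finite_qbox)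
  finally have "real (card ?B) \<le> real (\<Sum>t\<in>I. \<Sum>w\<in>qbox (c * h t). card (F t w))"
    by (simp only: of_nat_le_iff)
  also have "\<dots> = (\<Sum>t\<in>I. \<Sum>w\<in>qbox (c * h t). real (card (F t w)))" by simp
  also have "\<dots> \<le> (\<Sum>t\<in>I. \<Sum>w\<in>qbox (c * h t). (4 * ?T' / h t)\<^sup>2)"
    by (intro sum_mono cardF)
  also have "\<dots> \<le> (\<Sum>t\<in>I. 144 * c\<^sup>2 * ?T'\<^sup>2)"
  proof (intro sum_mono)
    fix t assume t: "t \<in> I"
    have h1: "1 \<le> h t" using hI t by auto
    have "1 * 1 \<le> c * h t" using c1 h1 by (intro mult_mono) auto
    hence "real (card (qbox (c * h t))) \<le> 9 * (c * h t)\<^sup>2" by (intro card_qbox_bounds) simp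
    hence "(\<Sum>w\<in>qbox (c * h t). (4 * ?T' / h t)\<^sup>2) \<le> 9 * (c * h t)\<^sup>2 * (4 * ?T' / h t)\<^sup>2"
      by (simp add: mult_right_mono)
    also have "\<dots> = 144 * c\<^sup>2 * ?T'\<^sup>2"
      using h1 by (simp add: power_mult_distrib power_divide)
    finally show "(\<Sum>w\<in>qbox (c * h t). (4 * ?T' / h t)\<^sup>2) \<le> 144 * c\<^sup>2 * ?T'\<^sup>2" .
  qed
  also have "\<dots> = real (card I) * (144 * c\<^sup>2 * ?T'\<^sup>2)" by simp
  also have "\<dots> \<le> (9 * H\<^sup>2) * (144 * c\<^sup>2 * ?T'\<^sup>2)"
    unfolding I_def by (intro mult_right_mono card_coord_square_nonzero H) simp
  also have "\<dots> = 1296 * c\<^sup>2 * ?T'\<^sup>2 * H\<^sup>2" by simp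
  finally show ?thesis .
qed

section \<open>Many slopes without small denominators\<close>

definition good_ratios :: "nat \<Rightarrow> real \<Rightarrow> real set" where
  "good_ratios T H = {a / b | a b. a \<in> qbox (real T) \<and> b \<in> large_norm T \<and> denominator_gap (a / b) H}"

text \<open>The value \<open>1 / 60\<close> makes the bound on bad pairs \<open>1296 / 3600 * T ^ 4\<close>, which is below
  \<open>T ^ 4 / 2\<close>.\<close>

definition gap_const :: real where
  "gap_const = 1 / (60 * ((1 + real k)\<^sup>2 * (real k + 2)) * (real k + 2))"

lemma gap_const_bounds: "0 < gap_const" "gap_const \<le> real k + 2"
proof -
  have "1 * 1 * 1 \<le> (60 * ((1 + real k)\<^sup>2 * (real k + 2))) * (real k + 2) * 1"
    by (intro mult_mono) (auto simp: one_le_power intro!: mult_ge1_I)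
  hence 1: "1 \<le> 60 * ((1 + real k)\<^sup>2 * (real k + 2)) * (real k + 2)" by simp
  thus "0 < gap_const" unfolding gap_const_def by simp
  have "gap_const \<le> 1" using 1 unfolding gap_const_def by simp
  thus "gap_const \<le> real k + 2" by simp
qed

lemma finite_good_ratios: "finite (good_ratios T H)"
  and card_good_ratios_le:
    "1 \<le> T \<Longrightarrow> real (card (good_ratios T H)) \<le> 81 * (real k + 2) ^ 4 * real T ^ 4"
proof -
  let ?T' = "(real k + 2) * real T"
  let ?Q = "qbox ?T' \<times> qbox ?T'"
  have "real T \<le> ?T'" by (simp add: algebra_simps)
  hence "good_ratios T H \<subseteq> (\<lambda>(a, b). a / b) ` ?Q"
    using large_norm_subset qbox_mono by (fastforce simp: good_ratios_def)
  moreover have fin: "finite ?Q" by (simp add: finite_qbox)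
  ultimately show "finite (good_ratios T H)" by (meson finite_imageI finite_subset)
  have "card (good_ratios T H) \<le> card ?Q"
    using \<open>good_ratios T H \<subseteq> _\<close> fin by (meson card_image_le card_mono finite_imageI le_trans)
  hence 1: "real (card (good_ratios T H)) \<le> real (card (qbox ?T')) * real (card (qbox ?T'))"
    by (metis card_cartesian_product of_nat_le_iff of_nat_mult)
  assume "1 \<le> T"
  hence "1 \<le> ?T'" using \<open>real T \<le> ?T'\<close> by linarith
  hence "real (card (qbox ?T')) \<le> 9 * ?T'\<^sup>2" by (rule card_qbox_bounds)
  hence "real (card (qbox ?T')) * real (card (qbox ?T')) \<le> (9 * ?T'\<^sup>2) * (9 * ?T'\<^sup>2)"
    by (intro mult_mono) auto
  also have "\<dots> = 81 * (real k + 2) ^ 4 * real T ^ 4"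
    by (simp add: power_mult_distrib power2_eq_square power4_eq_xxxx)
  finally show "real (card (good_ratios T H)) \<le> 81 * (real k + 2) ^ 4 * real T ^ 4"
    using 1 by linarith
qed

text \<open>At most half of the pairs are bad, and the others are shared out among the good ratios, each
  of which receives only boundedly many because its denominators have height of order \<open>T\<close>.\<close>

lemma card_good_ratios_ge:
  assumes T: "1 \<le> T"
  shows "gap_const\<^sup>2 / (32 * (real k + 2)\<^sup>2) * real T ^ 4 \<le> real (card (good_ratios T (gap_const * real T)))"
proof -
  let ?T' = "(real k + 2) * real T"
  define c where "c = (1 + real k)\<^sup>2 * (real k + 2)"
  define H where "H = gap_const * real T"
  define G where "G = qbox (real T) \<times> large_norm T"
  define B where "B = {(a, b) \<in> G. \<not> denominator_gap (a / b) H}"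
  define L where "L = good_ratios T H"
  have H: "0 < H" "H \<le> ?T'"
    using gap_const_bounds T unfolding H_def by (auto intro!: mult_right_mono)
  have c0: "0 < c" by (simp add: c_def add_pos_nonneg)
  have finG: "finite G"
    by (simp add: G_def finite_qbox finite_subset[OF large_norm_subset])
  have "real T ^ 4 \<le> real (card G)"
  proof -
    have "(real T)\<^sup>2 \<le> real (card (qbox (real T)))" using card_qbox_bounds(1)[of "real T"] T by linarith
    moreover have "real (T\<^sup>2) \<le> real (card (large_norm T))"
      using card_large_norm by (simp only: of_nat_le_iff)
    ultimately have "(real T)\<^sup>2 * real (T\<^sup>2) \<le> real (card (qbox (real T))) * real (card (large_norm T))"
      by (intro mult_mono) auto
    thus ?thesis by (simp add: G_def card_cartesian_product power2_eq_square power4_eq_xxxx)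
  qed
  moreover have "real (card B) \<le> real T ^ 4 / 2"
  proof -
    have "real (card B) \<le> 1296 * c\<^sup>2 * ?T'\<^sup>2 * H\<^sup>2"
      using card_pairs_small_denominator[OF T less_imp_le[OF H(1)] H(2)]
      by (simp add: B_def G_def c_def)
    also have "\<dots> = 1296 * (c * (real k + 2) * gap_const)\<^sup>2 * real T ^ 4"
      by (simp add: H_def power_mult_distrib power2_eq_square power4_eq_xxxx)
    also have "c * (real k + 2) * gap_const = 1 / 60"
      using c0 by (simp add: gap_const_def c_def[symmetric])
    finally show ?thesis by (simp add: power2_eq_square)
  qed
  moreover have "real (card G) \<le> real (card B) + real (card L) * (4 * ?T' / H)\<^sup>2"
  proof -
    have "G \<subseteq> B \<union> (\<Union>l\<in>L. {(a, b) \<in> G. a / b = l \<and> denominator_gap l H})"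
      by (auto simp: B_def L_def good_ratios_def G_def)
    hence "card G \<le> card (B \<union> (\<Union>l\<in>L. {(a, b) \<in> G. a / b = l \<and> denominator_gap l H}))"
      by (rule card_mono[rotated])
        (auto simp: B_def L_def finite_good_ratios intro: finite_subset[OF _ finG])
    also have "\<dots> \<le> card B + card (\<Union>l\<in>L. {(a, b) \<in> G. a / b = l \<and> denominator_gap l H})"
      by (rule card_Un_le)
    also have "\<dots> \<le> card B + (\<Sum>l\<in>L. card {(a, b) \<in> G. a / b = l \<and> denominator_gap l H})"
      by (intro add_left_mono card_UN_le) (simp add: L_def finite_good_ratios)
    finally have "real (card G) \<le> real (card B + (\<Sum>l\<in>L. card {(a, b) \<in> G. a / b = l \<and> denominator_gap l H}))"
      by (simp only: of_nat_le_iff)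
    also have "\<dots> = real (card B) + (\<Sum>l\<in>L. real (card {(a, b) \<in> G. a / b = l \<and> denominator_gap l H}))"
      by (simp only: of_nat_add of_nat_sum)
    also have "(\<Sum>l\<in>L. real (card {(a, b) \<in> G. a / b = l \<and> denominator_gap l H})) \<le> (\<Sum>l\<in>L. (4 * ?T' / H)\<^sup>2)"
    proof (intro sum_mono)
      fix l assume "l \<in> L"
      hence "denominator_gap l H" by (auto simp: L_def good_ratios_def)
      thus "real (card {(a, b) \<in> G. a / b = l \<and> denominator_gap l H}) \<le> (4 * ?T' / H)\<^sup>2"
        using card_pairs_with_ratio[OF T _ H] by (simp add: G_def)
    qed
    finally show ?thesis by simp
  qed
  moreover have "4 * ?T' / H = 4 * (real k + 2) / gap_const"
    using T by (simp add: H_def)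
  ultimately have "real T ^ 4 / 2 \<le> real (card L) * (4 * (real k + 2) / gap_const)\<^sup>2"
    by (simp only:)
  hence "real T ^ 4 / 2 \<le> real (card L) * (16 * (real k + 2)\<^sup>2) / gap_const\<^sup>2"
    by (simp only: power_divide power_mult_distrib) simp
  hence "real T ^ 4 / 2 * gap_const\<^sup>2 \<le> real (card L) * (16 * (real k + 2)\<^sup>2)"
    using gap_const_bounds(1) by (simp add: pos_le_divide_eq)
  moreover have "0 < (real k + 2)\<^sup>2" by (simp add: add_nonneg_pos)
  ultimately show ?thesis unfolding L_def H_def
    by (simp add: field_simps)
qed

section \<open>Sizes of projections\<close>

text \<open>A point of a fibre is determined by its second coordinate, and differences of second
  coordinates within a fibre are denominators of \<open>\<theta>\<close>.  Hence fibres are small, and the box squared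
  needs many of them.\<close>

lemma card_projection_ge:
  assumes gap: "denominator_gap \<theta> s" and s: "0 < s" "s \<le> R" "1 \<le> R"
  shows "s\<^sup>2 / 16 * real (card (qbox R)) \<le> real (card ((\<lambda>(x, y). x - \<theta> * y) ` (qbox R \<times> qbox R)))"
    (is "_ \<le> real (card (?\<pi> ` ?P))")
proof -
  have finP: "finite ?P" by (simp add: finite_qbox)
  have fibre: "real (card {z \<in> ?P. ?\<pi> z = t}) \<le> (4 * R / s)\<^sup>2" for t
  proof -
    let ?F = "{z \<in> ?P. ?\<pi> z = t}"
    have "inj_on snd ?F" by (auto simp: inj_on_def)
    hence "card ?F = card (snd ` ?F)" by (simp add: card_image)
    moreover have "real (card (snd ` ?F)) \<le> (4 * R / s)\<^sup>2"
    proof (rule packing[OF gap s(1,2)])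
      show "snd ` ?F \<subseteq> qbox R" by auto
      fix y y' assume "y \<in> snd ` ?F" "y' \<in> snd ` ?F"
      then obtain x x' where "x \<in> qbox R" "x' \<in> qbox R" "x - \<theta> * y = t" "x' - \<theta> * y' = t"
        by auto
      moreover from this have "\<theta> * (y - y') = x - x'" by (simp add: algebra_simps)
      ultimately show "\<theta> * (y - y') \<in> qring" by (simp add: qring_diff qbox_imp_qring)
    qed
    ultimately show ?thesis by simp
  qed
  have "card ?P = (\<Sum>t\<in>?\<pi> ` ?P. card {z \<in> ?P. ?\<pi> z = t})"
    using sum.image_gen[OF finP, of "\<lambda>_. 1::nat" ?\<pi>] by simp
  hence "real (card ?P) = (\<Sum>t\<in>?\<pi> ` ?P. real (card {z \<in> ?P. ?\<pi> z = t}))"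
    by (simp only: of_nat_sum)
  also have "\<dots> \<le> (\<Sum>t\<in>?\<pi> ` ?P. (4 * R / s)\<^sup>2)" by (intro sum_mono fibre)
  also have "\<dots> = real (card (?\<pi> ` ?P)) * (16 * R\<^sup>2 / s\<^sup>2)"
    by (simp add: power_divide power_mult_distrib)
  finally have "s\<^sup>2 / 16 * (real (card (qbox R)))\<^sup>2 \<le> real (card (?\<pi> ` ?P)) * R\<^sup>2"
    using s by (simp add: card_cartesian_product power2_eq_square field_simps)
  also have "\<dots> \<le> real (card (?\<pi> ` ?P)) * real (card (qbox R))"
    using card_qbox_bounds(1)[OF s(3)] by (intro mult_left_mono) auto
  finally have "(s\<^sup>2 / 16 * real (card (qbox R))) * real (card (qbox R))
      \<le> real (card (?\<pi> ` ?P)) * real (card (qbox R))"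
    by (simp add: power2_eq_square mult_ac)
  moreover have "0 < real (card (qbox R))"
    using card_qbox_bounds(1)[OF s(3)] s(3) by (rule_tac less_le_trans[of 0 "R\<^sup>2"]) auto
  ultimately show ?thesis by (simp only: mult_le_cancel_right_pos)
qed

text \<open>Multiplication by \<open>b\<close> injects the image into a box of radius \<open>O(S * R)\<close>.\<close>

lemma card_projection_le:
  assumes b: "b \<noteq> 0" and ab: "a \<in> qbox S" "b \<in> qbox S" and S: "1 \<le> S" and R: "1 \<le> R"
  shows "real (card ((\<lambda>(x, y). x - a / b * y) ` (qbox R \<times> qbox R)))
    \<le> 36 * (1 + real k)\<^sup>2 * S\<^sup>2 * real (card (qbox R))" (is "real (card (?\<pi> ` ?P)) \<le> _")
proof -
  let ?U = "(1 + real k) * S * R + (1 + real k) * S * R"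
  have "(\<lambda>t. b * t) ` ?\<pi> ` ?P \<subseteq> qbox ?U"
  proof clarify
    fix x y assume xy: "x \<in> qbox R" "y \<in> qbox R"
    have "b * (x - a / b * y) = b * x - a * y" using b by (simp add: field_simps)
    thus "b * (x - a / b * y) \<in> qbox ?U"
      using qbox_diff[OF qbox_mult[OF ab(2) xy(1)] qbox_mult[OF ab(1) xy(2)]] by simp
  qed
  moreover have "inj_on (\<lambda>t. b * t) (?\<pi> ` ?P)" using b by (auto simp: inj_on_def)
  ultimately have "card (?\<pi> ` ?P) \<le> card (qbox ?U)"
    by (metis card_image card_mono finite_qbox)
  moreover have "real (card (qbox ?U)) \<le> 9 * ?U\<^sup>2"
  proof (rule card_qbox_bounds)
    have "1 * 1 * 1 \<le> (1 + real k) * S * R" using S R by (intro mult_mono) auto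
    thus "1 \<le> ?U" by linarith
  qed
  moreover have "9 * ?U\<^sup>2 = 36 * (1 + real k)\<^sup>2 * S\<^sup>2 * R\<^sup>2"
    by (simp add: power2_eq_square algebra_simps)
  moreover have "36 * (1 + real k)\<^sup>2 * S\<^sup>2 * R\<^sup>2 \<le> 36 * (1 + real k)\<^sup>2 * S\<^sup>2 * real (card (qbox R))"
    by (intro mult_left_mono card_qbox_bounds R) auto
  ultimately show ?thesis by linarith
qed

lemma A_set_eq_qbox: "A_set k N = qbox (sqrt N)"
  by (force simp: A_set_def qbox_def elt_def abs_le_iff)

end

section \<open>From slopes to directions\<close>

definition slope_line :: "real \<Rightarrow> (real \<times> real) set" where
  "slope_line \<theta> = span {(\<theta>, 1)}"

lemma inj_slope_line: "inj slope_line"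
proof (rule injI)
  fix l m assume "slope_line l = slope_line m"
  moreover have "(l, 1 :: real) \<in> slope_line l" by (simp add: slope_line_def span_base)
  ultimately have "(l, 1 :: real) \<in> span {(m, 1)}" by (simp add: slope_line_def)
  thus "l = m" by (auto simp: span_singleton)
qed

lemma plane_direction_slope_line: "plane_direction (slope_line \<theta>)"
proof -
  have "independent {(\<theta>, 1 :: real)}" by (simp add: zero_prod_def)
  thus ?thesis unfolding plane_direction_def slope_line_def
    by (simp add: dim_eq_card_independent)
qed

lemma projection_along_slope_line: "projection_along (slope_line \<theta>) (\<lambda>(x, y). x - \<theta> * y)"
  unfolding projection_along_def
proof
  show "linear (\<lambda>(x, y). x - \<theta> * y)"
    by (rule linearI) (auto simp: algebra_simps)
  show "\<forall>x. {y. (case y of (x, y) \<Rightarrow> x - \<theta> * y) = (case x of (x, y) \<Rightarrow> x - \<theta> * y)} = {x + d |d. d \<in> slope_line \<theta>}"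
  proof (intro allI equalityI subsetI)
    fix z w assume "w \<in> {y. (case y of (x, y) \<Rightarrow> x - \<theta> * y) = (case z of (x, y) \<Rightarrow> x - \<theta> * y)}"
    then have "w = z + (snd w - snd z) *\<^sub>R (\<theta>, 1)"
      by (cases z; cases w) (simp add: algebra_simps)
    thus "w \<in> {z + d |d. d \<in> slope_line \<theta>}" by (auto simp: slope_line_def span_singleton)
  next
    fix z w assume "w \<in> {z + d |d. d \<in> slope_line \<theta>}"
    thus "w \<in> {y. (case y of (x, y) \<Rightarrow> x - \<theta> * y) = (case z of (x, y) \<Rightarrow> x - \<theta> * y)}"
      by (cases z) (auto simp: slope_line_def span_singleton algebra_simps)
  qed
qed

text \<open>Integer part of the fourth root of \<open>p\<close>; the hypothesis \<open>1 \<le> p\<close> keeps the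
  rounding loss within a factor of two.\<close>

lemma floor_fourth_root:
  assumes "1 \<le> (p :: real)"
  obtains T :: nat where "1 \<le> T" "(real T)\<^sup>2 \<le> sqrt p" "sqrt p \<le> 4 * (real T)\<^sup>2"
    "real T ^ 4 \<le> p" "p \<le> 16 * real T ^ 4"
proof -
  define q where "q = sqrt (sqrt p)"
  have q: "1 \<le> q" "q\<^sup>2 = sqrt p" "(q\<^sup>2)\<^sup>2 = p" using assms by (auto simp: q_def)
  define T where "T = nat \<lfloor>q\<rfloor>"
  have fl: "1 \<le> \<lfloor>q\<rfloor>" "of_int \<lfloor>q\<rfloor> \<le> q" "q < of_int \<lfloor>q\<rfloor> + 1" using q(1) by linarith+
  hence "real T = of_int \<lfloor>q\<rfloor>" by (simp add: T_def)
  hence T: "1 \<le> T" "real T \<le> q" "q \<le> 2 * real T" using fl by linarith+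
  have 1: "(real T)\<^sup>2 \<le> sqrt p"
    using T unfolding q(2)[symmetric] by (intro power_mono) auto
  have "q\<^sup>2 \<le> (2 * real T)\<^sup>2" using T q(1) by (intro power_mono) auto
  hence 2: "sqrt p \<le> 4 * (real T)\<^sup>2" unfolding q(2) by (simp add: power_mult_distrib)
  have sp: "(sqrt p)\<^sup>2 = p" using assms by simp
  have "((real T)\<^sup>2)\<^sup>2 \<le> (sqrt p)\<^sup>2" using 1 by (intro power_mono) auto
  hence 3: "real T ^ 4 \<le> p" unfolding sp by simp
  have "(sqrt p)\<^sup>2 \<le> (4 * (real T)\<^sup>2)\<^sup>2" using 2 assms by (intro power_mono) auto
  hence 4: "p \<le> 16 * real T ^ 4" unfolding sp by (simp add: power_mult_distrib)
  show ?thesis using that T(1) 1 2 3 4 by blast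
qed

theorem corollary1p6:
  fixes k :: nat
  assumes "k > 0" and "\<nexists>j :: nat. k = j\<^sup>2"
  shows "\<exists>c\<^sub>1 c\<^sub>2 C\<^sub>1 C\<^sub>2 :: real. c\<^sub>1 > 0 \<and> c\<^sub>2 > 0 \<and> C\<^sub>1 > 0 \<and> C\<^sub>2 > 0 \<and>
    (\<forall>p :: real. p \<ge> 1 \<longrightarrow>
      (\<exists>N\<^sub>0 :: real. \<forall>N :: real. N \<ge> N\<^sub>0 \<longrightarrow>
        (let A = A_set k N; P = A \<times> A; n = card A in
          \<exists>(m :: nat) (D :: nat \<Rightarrow> (real \<times> real) set) (\<pi> :: nat \<Rightarrow> real \<times> real \<Rightarrow> real).
            c\<^sub>1 * p \<le> real m \<and> real m \<le> c\<^sub>2 * p \<and>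
            inj_on D {1..m} \<and>
            (\<forall>i\<in>{1..m}. plane_direction (D i) \<and> projection_along (D i) (\<pi> i) \<and>
               C\<^sub>1 * sqrt p * real n \<le> real (card (\<pi> i ` P)) \<and>
               real (card (\<pi> i ` P)) \<le> C\<^sub>2 * sqrt p * real n))))"
proof -
  interpret real_quadratic_order k using assms(2) by unfold_locales
  define e where "e = gap_const"
  have e: "0 < e" "e \<le> real k + 2" using gap_const_bounds by (auto simp: e_def)
  have k2: "0 < real k + 2" by linarith
  define c\<^sub>1 where "c\<^sub>1 = e\<^sup>2 / (32 * (real k + 2)\<^sup>2) / 16"
  define c\<^sub>2 where "c\<^sub>2 = 81 * (real k + 2) ^ 4"
  define C\<^sub>1 where "C\<^sub>1 = e\<^sup>2 / 64"
  define C\<^sub>2 where "C\<^sub>2 = 36 * (1 + real k)\<^sup>2 * (real k + 2)\<^sup>2"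
  have pos: "c\<^sub>1 > 0" "c\<^sub>2 > 0" "C\<^sub>1 > 0" "C\<^sub>2 > 0"
    using e k2 by (auto simp: c\<^sub>1_def c\<^sub>2_def C\<^sub>1_def C\<^sub>2_def add_pos_nonneg intro!: mult_pos_pos divide_pos_pos)
  have main: "\<exists>N\<^sub>0 :: real. \<forall>N \<ge> N\<^sub>0. \<exists>(m :: nat) (D :: nat \<Rightarrow> (real \<times> real) set) \<pi>.
            c\<^sub>1 * p \<le> real m \<and> real m \<le> c\<^sub>2 * p \<and>
            inj_on D {1..m} \<and>
            (\<forall>i\<in>{1..m}. plane_direction (D i) \<and> projection_along (D i) (\<pi> i) \<and>
               C\<^sub>1 * sqrt p * real (card (A_set k N)) \<le> real (card (\<pi> i ` (A_set k N \<times> A_set k N))) \<and>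
               real (card (\<pi> i ` (A_set k N \<times> A_set k N))) \<le> C\<^sub>2 * sqrt p * real (card (A_set k N)))"
    if p: "1 \<le> p" for p :: real
  proof -
    obtain T :: nat where T: "1 \<le> T" "(real T)\<^sup>2 \<le> sqrt p" "sqrt p \<le> 4 * (real T)\<^sup>2"
      "real T ^ 4 \<le> p" "p \<le> 16 * real T ^ 4"
      using floor_fourth_root[OF p] .
    define S where "S = (real k + 2) * real T"
    have TS: "real T \<le> S" by (simp add: S_def algebra_simps)
    hence S1: "1 \<le> S" using T(1) by simp
    define L where "L = good_ratios T (e * real T)"
    define m where "m = card L"
    have "\<exists>f. bij_betw f {1..m} L"
      unfolding m_def by (rule finite_same_card_bij) (auto simp: L_def finite_good_ratios)
    then obtain f where f: "bij_betw f {1..m} L" by blast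
    have m1: "c\<^sub>1 * p \<le> real m"
    proof -
      have "c\<^sub>1 * p \<le> c\<^sub>1 * (16 * real T ^ 4)" using pos T by (intro mult_left_mono) auto
      also have "\<dots> \<le> real m"
        using card_good_ratios_ge[OF T(1)] by (simp add: c\<^sub>1_def m_def L_def e_def)
      finally show ?thesis .
    qed
    have m2: "real m \<le> c\<^sub>2 * p"
    proof -
      have "real m \<le> c\<^sub>2 * real T ^ 4"
        using card_good_ratios_le[OF T(1)] by (simp add: c\<^sub>2_def m_def L_def)
      also have "\<dots> \<le> c\<^sub>2 * p" using pos T by (intro mult_left_mono) auto
      finally show ?thesis .
    qed
    \<comment> \<open>From \<open>N = S\<^sup>2\<close> on, the box is wide enough for the packing bound with gap \<open>e * T\<close>.\<close>
    show ?thesis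
    proof (intro exI[of _ "S\<^sup>2"] allI impI)
      fix N :: real assume N: "S\<^sup>2 \<le> N"
      define R where "R = sqrt N"
      have R: "S \<le> R" "1 \<le> R"
        using real_le_rsqrt[OF N] S1 unfolding R_def by linarith+
      define n where "n = real (card (qbox R))"
      have A: "A_set k N = qbox R" by (simp add: A_set_eq_qbox R_def)
      show "\<exists>(m :: nat) (D :: nat \<Rightarrow> (real \<times> real) set) \<pi>.
            c\<^sub>1 * p \<le> real m \<and> real m \<le> c\<^sub>2 * p \<and>
            inj_on D {1..m} \<and>
            (\<forall>i\<in>{1..m}. plane_direction (D i) \<and> projection_along (D i) (\<pi> i) \<and>
               C\<^sub>1 * sqrt p * real (card (A_set k N)) \<le> real (card (\<pi> i ` (A_set k N \<times> A_set k N))) \<and>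
               real (card (\<pi> i ` (A_set k N \<times> A_set k N))) \<le> C\<^sub>2 * sqrt p * real (card (A_set k N)))"
        unfolding A n_def[symmetric]
      proof (rule exI[of _ m], rule exI[of _ "\<lambda>i. slope_line (f i)"],
          rule exI[of _ "\<lambda>i. \<lambda>(x, y). x - f i * y"],
          intro conjI[OF m1] conjI[OF m2] conjI ballI)
        show "inj_on (\<lambda>i. slope_line (f i)) {1..m}"
        proof (rule inj_onI)
          fix i j assume ij: "i \<in> {1..m}" "j \<in> {1..m}" "slope_line (f i) = slope_line (f j)"
          have "f i = f j" by (rule injD[OF inj_slope_line ij(3)])
          thus "i = j" by (rule inj_onD[OF bij_betw_imp_inj_on[OF f] _ ij(1,2)])
        qed
        fix i assume "i \<in> {1..m}"
        show "plane_direction (slope_line (f i))" by (rule plane_direction_slope_line)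
        show "projection_along (slope_line (f i)) (\<lambda>(x, y). x - f i * y)"
          by (rule projection_along_slope_line)
        have "f i \<in> L" using \<open>i \<in> {1..m}\<close> f by (auto simp: bij_betw_def)
        then obtain a b where ab: "f i = a / b" "a \<in> qbox (real T)" "b \<in> large_norm T"
          and gap: "denominator_gap (f i) (e * real T)"
          by (auto simp: L_def good_ratios_def)
        let ?c = "real (card ((\<lambda>(x, y). x - f i * y) ` (qbox R \<times> qbox R)))"
        have n0: "0 \<le> n" by (simp add: n_def)
        have "e * real T \<le> R"
          using e R(1) mult_right_mono[OF e(2), of "real T"] by (simp add: S_def)
        hence lo: "(e * real T)\<^sup>2 / 16 * n \<le> ?c"
          unfolding n_def using e T(1) R(2) by (intro card_projection_ge[OF gap]) auto
        have "C\<^sub>1 * sqrt p * n \<le> C\<^sub>1 * (4 * (real T)\<^sup>2) * n"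
          using pos T n0 by (intro mult_right_mono mult_left_mono) auto
        also have "\<dots> = (e * real T)\<^sup>2 / 16 * n" by (simp add: C\<^sub>1_def power_mult_distrib)
        finally show "C\<^sub>1 * sqrt p * n \<le> ?c" using lo by linarith
        have "?c \<le> 36 * (1 + real k)\<^sup>2 * S\<^sup>2 * n"
          unfolding n_def ab(1) using large_norm_nonzero[OF T(1) ab(3)] S1 R(2) ab(2,3) TS large_norm_subset[of T]
          by (intro card_projection_le) (auto simp: S_def intro: qbox_mono)
        also have "\<dots> = C\<^sub>2 * (real T)\<^sup>2 * n" by (simp add: C\<^sub>2_def S_def power_mult_distrib)
        also have "\<dots> \<le> C\<^sub>2 * sqrt p * n"
          using pos T n0 by (intro mult_right_mono mult_left_mono) auto
        finally show "?c \<le> C\<^sub>2 * sqrt p * n" .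
      qed
    qed
  qed
  show ?thesis
    unfolding Let_def
    by (intro exI[of _ c\<^sub>1] exI[of _ c\<^sub>2] exI[of _ C\<^sub>1] exI[of _ C\<^sub>2] conjI pos allI impI main)
qed

end
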